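(* Let $P$ be the distribution of the binary random vector $X=(X_v)_{v\in V}$ of a discrete determinantal point process on a finite set $V$ with kernel $K$. Then $P$ is (globally) Markov with respect to the bidirected graph $G_b(P)$; that is, for all pairwise disjoint subsets $A,B,S$ of $V$ with $A,B$ non-empty ($S$ possibly empty), if every path in $G_b(P)$ between a vertex of $A$ and a vertex of $B$ contains a vertex outside $A\cup B\cup S$, then $X_A$ and $X_B$ are conditionally independent given $X_S$.
   Context: Let $V$ be a finite set. A (discrete) determinantal point process (DPP) on $V$ with kernel $K$ is a random subset $Y$ of $V$ such that $\mathbb{P}(A\subseteq Y)=\det(K_A)$ for all non-empty $A\subseteq V$, where $K\in\mathbb{R}^{V\times V}$ is a (symmetric) positive definite matrix with all eigenvalues at most $1$, and $K_A$ is the principal submatrix of $K$ with rows and columns indexed by $A$. Equivalently, the DPP is the binary random vector $X=(X_v)_{v\in V}\in\{0,1\}^V$ with $X_v=1$ iff $v\in Y$. For $A\subseteq V$, $X_A=(X_v)_{v\in A}$; conditional independence given $X_\varnothing$ means (marginal) independence. $G_b(P)$ is the bidirected graph (all edges bidirected; as a combinatorial object, a simple graph) with node set $V$ in which distinct nodes $i$ and $j$ are non-adjacent if and only if $K_{ij}=0$. Endpoints of a path count as its vertices. *)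

theory Defs
  imports "HOL-Probability.Probability"
begin

section \<open>Determinantal point processes\<close>

text \<open>
  The ground set is the finite type \<open>'v\<close>.
  A subset \<open>A\<close> of \<open>'v\<close> is not a type, so \<^const>\<open>det\<close> does not apply to the submatrix
  with rows and columns indexed by \<open>A\<close>; its determinant is given by the Leibniz formula
  over the permutations of \<open>A\<close>. The lemma \<open>det_principal_eq_det\<close> shows that this is the library
  determinant of that submatrix for any indexing of \<open>A\<close> by a finite type.
\<close>

definition det_principal :: "real^'v^'v \<Rightarrow> 'v::finite set \<Rightarrow> real" where
  "det_principal K A = (\<Sum>p | p permutes A. of_int (sign p) * (\<Prod>i\<in>A. K $ i $ p i))"

lemma det_principal_eq_det:
  fixes K :: "real^'v^'v::finite" and f :: "'n::finite \<Rightarrow> 'v"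
  assumes "bij_betw f UNIV A"
  shows "det_principal K A = det (\<chi> i j. K $ f i $ f j)"
proof -
  have inj: "inj f" and A: "f ` UNIV = A"
    using assms by (auto simp: bij_betw_def)
  have bij: "bij_betw (map_permutation UNIV f) {p. p permutes UNIV} {p. p permutes A}"
  proof -
    have "(\<lambda>p x. if x \<in> A then f (p (inv_into UNIV f x)) else x) = map_permutation UNIV f"
      by (auto simp: map_permutation_def restrict_id_def fun_eq_iff A)
    then show ?thesis
      using bij_betw_permutations[OF assms] by simp
  qed
  have "det_principal K A =
      (\<Sum>p | p permutes UNIV. of_int (sign (map_permutation UNIV f p)) *
        (\<Prod>i\<in>A. K $ i $ map_permutation UNIV f p i))"
    unfolding det_principal_def by (rule sum.reindex_bij_betw[OF bij, symmetric])
  also have "\<dots> = (\<Sum>p | p permutes UNIV. of_int (sign p) * (\<Prod>i\<in>UNIV. K $ f i $ f (p i)))"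
  proof (rule sum.cong[OF refl])
    fix p :: "'n \<Rightarrow> 'n" assume "p \<in> {p. p permutes UNIV}"
    then have p: "p permutes UNIV" by simp
    have "(\<Prod>i\<in>A. K $ i $ map_permutation UNIV f p i) = (\<Prod>i\<in>UNIV. K $ f i $ f (p i))"
      by (subst prod.reindex_bij_betw[OF assms, symmetric])
         (simp add: map_permutation_apply[OF inj])
    then show "of_int (sign (map_permutation UNIV f p)) *
        (\<Prod>i\<in>A. K $ i $ map_permutation UNIV f p i) =
      of_int (sign p) * (\<Prod>i\<in>UNIV. K $ f i $ f (p i))"
      using sign_map_permutation[OF inj p] by simp
  qed
  also have "\<dots> = det (\<chi> i j. K $ f i $ f j)"
    by (simp add: det_def)
  finally show ?thesis .
qed

definition dpp_kernel :: "real^'v^'v \<Rightarrow> bool" where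
  "dpp_kernel K \<longleftrightarrow>
     transpose K = K \<and>
     (\<forall>x. x \<noteq> 0 \<longrightarrow> x \<bullet> (K *v x) > 0) \<and>
     (\<forall>c x. x \<noteq> 0 \<and> K *v x = c *\<^sub>R x \<longrightarrow> c \<le> 1)"

definition dpp :: "'w measure \<Rightarrow> ('w \<Rightarrow> 'v::finite set) \<Rightarrow> real^'v^'v \<Rightarrow> bool" where
  "dpp M Y K \<longleftrightarrow>
     prob_space M \<and> Y \<in> measurable M (count_space UNIV) \<and> dpp_kernel K \<and>
     (\<forall>A. A \<noteq> {} \<longrightarrow> \<P>(\<omega> in M. A \<subseteq> Y \<omega>) = det_principal K A)"

definition binary_vector :: "('w \<Rightarrow> 'v set) \<Rightarrow> 'w \<Rightarrow> 'v \<Rightarrow> nat" where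
  "binary_vector Y \<omega> v = (if v \<in> Y \<omega> then 1 else 0)"

definition binary_law :: "'w measure \<Rightarrow> ('w \<Rightarrow> 'v set) \<Rightarrow> ('v \<Rightarrow> nat) measure" where
  "binary_law M Y = distr M (count_space (UNIV \<rightarrow> {0, 1})) (binary_vector Y)"


section \<open>Conditional independence given a discrete random variable\<close>

text \<open>
  This definition is only meant for random variables with finitely many values on a space where
  all the events involved are measurable. Values of the conditioning variable that have
  probability \<open>0\<close> impose no condition.
\<close>

definition cond_indep :: "'a measure \<Rightarrow> ('a \<Rightarrow> 'b) \<Rightarrow> ('a \<Rightarrow> 'c) \<Rightarrow> ('a \<Rightarrow> 'd) \<Rightarrow> bool" where
  "cond_indep M X Y Z \<longleftrightarrow>
     (\<forall>z. \<P>(\<omega> in M. Z \<omega> = z) > 0 \<longrightarrow>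
       (\<forall>E F. \<P>(\<omega> in M. X \<omega> \<in> E \<and> Y \<omega> \<in> F \<bar> Z \<omega> = z) =
              \<P>(\<omega> in M. X \<omega> \<in> E \<bar> Z \<omega> = z) * \<P>(\<omega> in M. Y \<omega> \<in> F \<bar> Z \<omega> = z)))"

lemma sigma_sets_vimage_all:
  "sigma_sets \<Omega> {Z -` E \<inter> \<Omega> | E. True} = {Z -` E \<inter> \<Omega> | E. True}"
  using sigma_sets_vimage_commute[of Z \<Omega> UNIV UNIV] sigma_sets.Basic[of _ UNIV UNIV] by simp

text \<open>Conditioning on a constant, such as \<open>X\<^sub>S\<close> for empty \<open>S\<close>, is ordinary independence.\<close>

lemma (in prob_space) cond_indep_const:
  assumes X: "X \<in> measurable M (count_space UNIV)" and Y: "Y \<in> measurable M (count_space UNIV)"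
  shows "cond_indep M X Y (\<lambda>_. c) \<longleftrightarrow> indep_var (count_space UNIV) X (count_space UNIV) Y"
proof -
  have meas: "X -` E \<inter> space M \<in> events" "Y -` F \<inter> space M \<in> events" for E F
    using measurable_sets[OF X] measurable_sets[OF Y] by auto
  have "indep_var (count_space UNIV) X (count_space UNIV) Y \<longleftrightarrow>
      indep_set {X -` E \<inter> space M | E. True} {Y -` F \<inter> space M | F. True}"
    using X Y unfolding indep_var_eq by (simp add: sigma_sets_vimage_all[simplified])
  also have "\<dots> \<longleftrightarrow> (\<forall>E F. prob ((X -` E \<inter> space M) \<inter> (Y -` F \<inter> space M)) =
      prob (X -` E \<inter> space M) * prob (Y -` F \<inter> space M))"
    unfolding indep_sets2_eq using meas by blast
  also have "\<dots> \<longleftrightarrow> cond_indep M X Y (\<lambda>_. c)"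
  proof -
    have eqs: "(X -` E \<inter> space M) \<inter> (Y -` F \<inter> space M) = {\<omega> \<in> space M. X \<omega> \<in> E \<and> Y \<omega> \<in> F}"
      "X -` E \<inter> space M = {\<omega> \<in> space M. X \<omega> \<in> E}"
      "Y -` F \<inter> space M = {\<omega> \<in> space M. Y \<omega> \<in> F}" for E F
      by auto
    have "prob {\<omega> \<in> space M. c = z} = (if z = c then 1 else 0)" for z
      by (simp add: prob_space)
    then show ?thesis
      unfolding cond_indep_def cond_prob_def eqs(1) unfolding eqs(2,3) by (simp add: prob_space)
  qed
  finally show ?thesis ..
qed


section \<open>Bidirected graphs and their global Markov property\<close>

text \<open>
  A bidirected graph on \<open>'v\<close> has only bidirected edges and is given by its symmetric irreflexive
  adjacency relation.
\<close>

definition bidirected_graph :: "real^'v^'v \<Rightarrow> 'v \<Rightarrow> 'v \<Rightarrow> bool" where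
  "bidirected_graph K i j \<longleftrightarrow> i \<noteq> j \<and> K $ i $ j \<noteq> 0"

definition is_path :: "('v \<Rightarrow> 'v \<Rightarrow> bool) \<Rightarrow> 'v \<Rightarrow> 'v list \<Rightarrow> 'v \<Rightarrow> bool" where
  "is_path adj a p b \<longleftrightarrow>
     p \<noteq> [] \<and> hd p = a \<and> last p = b \<and> distinct p \<and> successively adj p"

definition bidirected_markov :: "('v \<Rightarrow> 'v \<Rightarrow> bool) \<Rightarrow> ('v \<Rightarrow> nat) measure \<Rightarrow> bool" where
  "bidirected_markov adj P \<longleftrightarrow>
     (\<forall>A B S. A \<noteq> {} \<and> B \<noteq> {} \<and> A \<inter> B = {} \<and> A \<inter> S = {} \<and> B \<inter> S = {} \<and>
        (\<forall>a\<in>A. \<forall>b\<in>B. \<forall>p. is_path adj a p b \<longrightarrow> (\<exists>v\<in>set p. v \<notin> A \<union> B \<union> S)) \<longrightarrow>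
        cond_indep P (\<lambda>x. restrict x A) (\<lambda>x. restrict x B) (\<lambda>x. restrict x S))"

end

theory Submission
  imports Defs
begin

text \<open>
  Let \<open>C\<close> be the set of vertices that can be reached from \<open>A\<close> inside \<open>U = A \<union> B \<union> S\<close>, and let
  \<open>D = U - C\<close>, so that \<open>B \<subseteq> D\<close>. The kernel vanishes between \<open>C\<close> and \<open>D\<close>, hence its principal minors
  factorize and \<open>Y \<inter> C\<close>, \<open>Y \<inter> D\<close> are independent. Now \<open>X\<^sub>A\<close> is a function of the former, \<open>X\<^sub>B\<close> a
  function of the latter, and the event \<open>X\<^sub>S = z\<close> is the intersection of an event of each of the two.
\<close>

lemma det_principal_empty [simp]: "det_principal K {} = 1"
  by (simp add: det_principal_def)

text \<open>In the Leibniz sum over \<open>C \<union> D\<close>, a permutation sending some element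
  of \<open>C\<close> into \<open>D\<close> picks a zero entry. The remaining ones preserve both
  blocks and correspond to pairs of permutations of \<open>C\<close> and of \<open>D\<close>, with
  multiplicative signs. This is the block triangular determinant formula: the zero block is the one
  with rows in \<open>C\<close> and columns in \<open>D\<close>.\<close>

lemma det_principal_Un:
  fixes K :: "real^'v^'v::finite"
  assumes CD: "C \<inter> D = {}" and K: "\<And>i j. i \<in> C \<Longrightarrow> j \<in> D \<Longrightarrow> K $ i $ j = 0"
  shows "det_principal K (C \<union> D) = det_principal K C * det_principal K D"
proof -
  let ?t = "\<lambda>A p. of_int (sign p) * (\<Prod>i\<in>A. K $ i $ p i)"
  have zero: "?t (C \<union> D) p = 0" if p: "p permutes C \<union> D" and "\<not> p ` C \<subseteq> C" for p
  proof -
    from that obtain i where i: "i \<in> C" "p i \<notin> C" by auto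
    moreover from i have "p i \<in> C \<union> D" using permutes_in_image[OF p, of i] by auto
    ultimately have "i \<in> C \<union> D" "K $ i $ p i = 0" using K by auto
    then show ?thesis by (auto intro!: prod_zero)
  qed
  have restr: "restrict_id p C permutes C" "restrict_id p D permutes D"
    if p: "p permutes C \<union> D" and s: "p ` C \<subseteq> C" for p
  proof -
    have inj: "inj p" using p by (rule permutes_inj)
    have "p ` C = C"
      by (rule endo_inj_surj) (use s inj in \<open>auto intro: inj_on_subset\<close>)
    moreover have "p ` D = D"
    proof -
      have "D = (C \<union> D) - C" using CD by blast
      then show ?thesis
        using image_set_diff[OF inj, of "C \<union> D" C] permutes_image[OF p] \<open>p ` C = C\<close> by simp
    qed
    ultimately have "bij_betw p C C" "bij_betw p D D"
      using inj by (auto simp: bij_betw_def intro: inj_on_subset)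
    then show "restrict_id p C permutes C" "restrict_id p D permutes D"
      by (auto intro: permutes_restrict_id)
  qed
  have comp: "restrict_id p C \<circ> restrict_id p D = p" if p: "p permutes C \<union> D" "p ` C \<subseteq> C" for p
  proof
    fix x
    have "x \<in> D \<Longrightarrow> p x \<in> D" using permutes_in_image[OF restr(2)[OF p], of x] by auto
    then show "(restrict_id p C \<circ> restrict_id p D) x = p x"
      using CD permutes_not_in[OF p(1), of x] by (auto simp: restrict_id_def)
  qed
  have "det_principal K (C \<union> D) = sum (?t (C \<union> D)) {p. p permutes C \<union> D \<and> p ` C \<subseteq> C}"
    unfolding det_principal_def
    by (rule sum.mono_neutral_right) (use zero in \<open>auto simp: finite_permutations\<close>)
  also have "\<dots> = (\<Sum>(q, r)\<in>{q. q permutes C} \<times> {r. r permutes D}. ?t C q * ?t D r)"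
  \<comment> \<open>Splitting into restrictions and composing are mutually inverse. Goals 1 and 3
    are the two inverse laws, 2 and 4 the two membership claims, and 5 compares the
    summands.\<close>
  proof (rule sum.reindex_bij_witness[where
        i = "\<lambda>(q, r). q \<circ> r" and j = "\<lambda>p. (restrict_id p C, restrict_id p D)"], goal_cases)
    case (1 p)
    then show ?case using comp by simp
  next
    case (2 p)
    then show ?case using restr by auto
  next
    case (3 qr)
    then obtain q r where qr: "qr = (q, r)" "q permutes C" "r permutes D" by auto
    have "q (r x) = q x" if "x \<in> C" for x
    proof -
      have "x \<notin> D" using that CD by blast
      then show ?thesis using permutes_not_in[OF qr(3)] by simp
    qed
    moreover have "q (r x) = r x" if "x \<in> D" for x
    proof -
      have "r x \<notin> C" using that CD permutes_in_image[OF qr(3), of x] by blast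
      then show ?thesis using permutes_not_in[OF qr(2)] by simp
    qed
    ultimately show ?case
      using permutes_not_in[OF qr(2)] permutes_not_in[OF qr(3)]
      by (auto simp: qr(1) restrict_id_def fun_eq_iff)
  next
    case (4 qr)
    then obtain q r where qr: "qr = (q, r)" "q permutes C" "r permutes D" by auto
    have "(q \<circ> r) permutes C \<union> D"
      by (intro permutes_compose permutes_subset[OF qr(2)] permutes_subset[OF qr(3)]) auto
    moreover have "q (r x) \<in> C" if "x \<in> C" for x
    proof -
      have "x \<notin> D" using that CD by blast
      then show ?thesis using that permutes_not_in[OF qr(3)] permutes_in_image[OF qr(2)] by simp
    qed
    ultimately show ?case by (auto simp: qr(1))
  next
    case (5 p)
    then have p: "p permutes C \<union> D" "p ` C \<subseteq> C" by auto
    note r = restr[OF this]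
    have "sign p = sign (restrict_id p C) * sign (restrict_id p D)"
      using sign_compose[OF permutes_imp_permutation[OF _ r(1)] permutes_imp_permutation[OF _ r(2)]]
      by (simp add: comp[OF p])
    moreover have "(\<Prod>i\<in>C. K $ i $ restrict_id p C i) = (\<Prod>i\<in>C. K $ i $ p i)"
      "(\<Prod>i\<in>D. K $ i $ restrict_id p D i) = (\<Prod>i\<in>D. K $ i $ p i)"
      by simp_all
    ultimately show ?case
      by (simp add: prod.union_disjoint CD)
  qed
  also have "\<dots> = det_principal K C * det_principal K D"
    by (simp add: det_principal_def sum_product sum.cartesian_product)
  finally show ?thesis .
qed

text \<open>A pi-system argument: the events \<open>T \<subseteq> Y \<omega>\<close> with
  \<open>T \<subseteq> C\<close> are closed under intersection, since \<open>T\<close> and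
  \<open>T'\<close> combine to \<open>T \<union> T'\<close>, and their sigma-algebra contains every
  event about \<open>Y \<omega> \<inter> C\<close>. So the product rule on these inclusion events,
  for \<open>C\<close> and for \<open>D\<close>, extends to all events.\<close>

lemma (in prob_space) indep_var_random_sets:
  fixes Y :: "'a \<Rightarrow> 'v::finite set"
  assumes Y[measurable]: "Y \<in> measurable M (count_space UNIV)"
    and eq: "\<And>T U. T \<subseteq> C \<Longrightarrow> U \<subseteq> D \<Longrightarrow>
      \<P>(\<omega> in M. T \<union> U \<subseteq> Y \<omega>) = \<P>(\<omega> in M. T \<subseteq> Y \<omega>) * \<P>(\<omega> in M. U \<subseteq> Y \<omega>)"
  shows "indep_var (count_space UNIV) (\<lambda>\<omega>. Y \<omega> \<inter> C) (count_space UNIV) (\<lambda>\<omega>. Y \<omega> \<inter> D)"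
proof -
  define G where "G C = {{\<omega> \<in> space M. T \<subseteq> Y \<omega>} | T. T \<subseteq> C}" for C
  have G_events: "G C \<subseteq> events" for C
    unfolding G_def by auto
  have stable: "Int_stable (G C)" for C
  proof (rule Int_stableI)
    fix a b assume "a \<in> G C" "b \<in> G C"
    then obtain T T' where "a = {\<omega> \<in> space M. T \<subseteq> Y \<omega>}" "b = {\<omega> \<in> space M. T' \<subseteq> Y \<omega>}"
      "T \<subseteq> C" "T' \<subseteq> C" unfolding G_def by auto
    then have "a \<inter> b = {\<omega> \<in> space M. T \<union> T' \<subseteq> Y \<omega>}" "T \<union> T' \<subseteq> C" by auto
    then show "a \<inter> b \<in> G C" unfolding G_def by blast
  qed
  have "indep_set (G C) (G D)"
    unfolding indep_sets2_eq
  proof (intro conjI ballI G_events)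
    fix a b assume "a \<in> G C" "b \<in> G D"
    then obtain T U where TU: "a = {\<omega> \<in> space M. T \<subseteq> Y \<omega>}" "b = {\<omega> \<in> space M. U \<subseteq> Y \<omega>}"
      "T \<subseteq> C" "U \<subseteq> D" unfolding G_def by auto
    then have "a \<inter> b = {\<omega> \<in> space M. T \<union> U \<subseteq> Y \<omega>}" by auto
    then show "prob (a \<inter> b) = prob a * prob b" using eq TU by simp
  qed
  then have ind: "indep_set (sigma_sets (space M) (G C)) (sigma_sets (space M) (G D))"
    by (intro indep_set_sigma_sets stable)
  have sub: "sigma_sets (space M) {(\<lambda>\<omega>. Y \<omega> \<inter> C) -` E \<inter> space M | E. E \<in> sets (count_space UNIV)}
      \<subseteq> sigma_sets (space M) (G C)" for C
  proof (rule sigma_sets_mono, clarsimp)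
    fix E
    let ?N = "sigma (space M) (G C)"
    have G_Pow: "G C \<subseteq> Pow (space M)" unfolding G_def by auto
    have v: "Measurable.pred ?N (\<lambda>\<omega>. v \<in> Y \<omega>)" if "v \<in> C" for v
    proof -
      have "{\<omega> \<in> space M. {v} \<subseteq> Y \<omega>} \<in> G C" unfolding G_def using that by blast
      then have "{\<omega> \<in> space M. v \<in> Y \<omega>} \<in> sets ?N" using G_Pow by (auto simp: sets_measure_of)
      then show ?thesis using G_Pow by (simp add: pred_def space_measure_of)
    qed
    \<comment> \<open>Finiteness of \<open>'v\<close> makes the event
      \<open>Y \<omega> \<inter> C \<in> E\<close> a finite Boolean combination of the events
      \<open>v \<in> Y \<omega>\<close> with \<open>v \<in> C\<close>, which are the generators for
      singletons \<open>T\<close>.\<close>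
    have "Measurable.pred ?N (\<lambda>\<omega>. \<exists>Z\<in>E. Z \<subseteq> C \<and> (\<forall>v\<in>C. v \<in> Y \<omega> \<longleftrightarrow> v \<in> Z))"
      by (intro pred_intros_finite pred_intros_logic v) auto
    moreover have "(\<exists>Z\<in>E. Z \<subseteq> C \<and> (\<forall>v\<in>C. v \<in> Y \<omega> \<longleftrightarrow> v \<in> Z)) \<longleftrightarrow> Y \<omega> \<inter> C \<in> E" for \<omega>
      by (rule iffI)
        (clarify, metis (no_types, lifting) Int_iff equalityI subset_iff,
         rule bexI[of _ "Y \<omega> \<inter> C"], auto)
    ultimately have "{\<omega> \<in> space M. Y \<omega> \<inter> C \<in> E} \<in> sets ?N"
      using G_Pow by (simp add: pred_def space_measure_of)
    moreover have "(\<lambda>\<omega>. Y \<omega> \<inter> C) -` E \<inter> space M = {\<omega> \<in> space M. Y \<omega> \<inter> C \<in> E}" by auto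
    ultimately show "(\<lambda>\<omega>. Y \<omega> \<inter> C) -` E \<inter> space M \<in> sigma_sets (space M) (G C)"
      using G_Pow by (simp add: sets_measure_of)
  qed
  have rv: "(\<lambda>\<omega>. Y \<omega> \<inter> C) \<in> measurable M (count_space UNIV)" for C
    by measurable
  show ?thesis
    unfolding indep_var_eq
    using ind sub rv unfolding indep_sets2_eq by blast
qed

text \<open>Condition \<open>h\<close> makes each nonempty fibre of \<open>h\<close> a rectangle, so
  \<open>Z \<omega> = z\<close> is a \<open>V\<close>-event intersected with a
  \<open>W\<close>-event. Conditioning on such an intersection preserves the independence of
  \<open>V\<close> and \<open>W\<close>, hence that of functions of them.\<close>

lemma (in prob_space) cond_indep_of_indep_var:
  assumes ind: "indep_var (count_space UNIV) V (count_space UNIV) W"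
    and X: "\<And>\<omega>. \<omega> \<in> space M \<Longrightarrow> X \<omega> = f (V \<omega>)"
    and Y: "\<And>\<omega>. \<omega> \<in> space M \<Longrightarrow> Y \<omega> = g (W \<omega>)"
    and Z: "\<And>\<omega>. \<omega> \<in> space M \<Longrightarrow> Z \<omega> = h (V \<omega>) (W \<omega>)"
    and h: "\<And>v v' w w'. h v w = h v' w' \<longleftrightarrow> h1 v = h1 v' \<and> h2 w = h2 w'"
  shows "cond_indep M X Y Z"
  unfolding cond_indep_def
proof (intro allI impI)
  fix z E F
  assume pos: "\<P>(\<omega> in M. Z \<omega> = z) > 0"
  \<comment> \<open>Positive probability supplies a sample point, whose values \<open>v\<close> and
    \<open>w\<close> represent the fibre of \<open>z\<close>.\<close>
  then have "{\<omega> \<in> space M. Z \<omega> = z} \<noteq> {}" by (metis less_irrefl measure_empty)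
  then obtain v w where z: "z = h v w" using Z by blast
  have split: "\<P>(\<omega> in M. V \<omega> \<in> P \<and> W \<omega> \<in> Q) = \<P>(\<omega> in M. V \<omega> \<in> P) * \<P>(\<omega> in M. W \<omega> \<in> Q)" for P Q
    using indep_varD[OF ind, of P Q] by (simp add: vimage_def Int_def conj_commute)
  define P where "P = {v'. h1 v' = h1 v}"
  define Q where "Q = {w'. h2 w' = h2 w}"
  have ev: "{\<omega> \<in> space M. Z \<omega> = z} = {\<omega> \<in> space M. V \<omega> \<in> P \<and> W \<omega> \<in> Q}"
    "{\<omega> \<in> space M. (X \<omega> \<in> E \<and> Y \<omega> \<in> F) \<and> Z \<omega> = z} =
      {\<omega> \<in> space M. V \<omega> \<in> P \<inter> f -` E \<and> W \<omega> \<in> Q \<inter> g -` F}"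
    "{\<omega> \<in> space M. X \<omega> \<in> E \<and> Z \<omega> = z} = {\<omega> \<in> space M. V \<omega> \<in> P \<inter> f -` E \<and> W \<omega> \<in> Q}"
    "{\<omega> \<in> space M. Y \<omega> \<in> F \<and> Z \<omega> = z} = {\<omega> \<in> space M. V \<omega> \<in> P \<and> W \<omega> \<in> Q \<inter> g -` F}"
    using h by (auto simp: X Y Z z P_def Q_def)
  show "\<P>(\<omega> in M. X \<omega> \<in> E \<and> Y \<omega> \<in> F \<bar> Z \<omega> = z) =
      \<P>(\<omega> in M. X \<omega> \<in> E \<bar> Z \<omega> = z) * \<P>(\<omega> in M. Y \<omega> \<in> F \<bar> Z \<omega> = z)"
    \<comment> \<open>All four probabilities factor; \<open>pos\<close> makes the factors for
      \<open>P\<close> and \<open>Q\<close> nonzero, so they cancel.\<close>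
    using pos unfolding cond_prob_def ev split by (simp add: field_simps)
qed

text \<open>Conditional independence involves only probabilities of events, and these pull back
  along \<open>T\<close>. It moves the claim from the law of the binary vector to the underlying
  space.\<close>

lemma cond_indep_distr_count_space:
  assumes T: "T \<in> measurable M (count_space \<Omega>)"
  shows "cond_indep (distr M (count_space \<Omega>) T) X Y Z \<longleftrightarrow>
    cond_indep M (\<lambda>\<omega>. X (T \<omega>)) (\<lambda>\<omega>. Y (T \<omega>)) (\<lambda>\<omega>. Z (T \<omega>))"
proof -
  have "\<P>(x in distr M (count_space \<Omega>) T. \<phi> x) = \<P>(\<omega> in M. \<phi> (T \<omega>))" for \<phi>
  proof -
    have "T -` {x \<in> \<Omega>. \<phi> x} \<inter> space M = {\<omega> \<in> space M. \<phi> (T \<omega>)}"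
      using measurable_space[OF T] by auto
    then show ?thesis by (simp add: measure_distr[OF T])
  qed
  then show ?thesis by (simp add: cond_indep_def cond_prob_def)
qed

text \<open>A walk is turned into a path step by step: a new vertex is appended, while a repeated
  one cuts the path back to its earlier occurrence. The relation constrains only the targets of
  steps, so the start needs \<open>a \<in> U\<close> separately.\<close>

lemma rtranclp_imp_is_path:
  assumes "(\<lambda>i j. adj i j \<and> j \<in> U)\<^sup>*\<^sup>* a b" and "a \<in> U"
  shows "\<exists>p. is_path adj a p b \<and> set p \<subseteq> U"
  using assms(1)
proof (induction rule: rtranclp_induct)
  case base
  then show ?case using assms(2) by (intro exI[of _ "[a]"]) (simp add: is_path_def)
next
  case (step y z)
  then obtain p where p: "is_path adj a p y" "set p \<subseteq> U" by blast
  show ?case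
  proof (cases "z \<in> set p")
    case True
    then obtain xs ys where "p = (xs @ [z]) @ ys" by (auto dest: split_list)
    then have "is_path adj a (xs @ [z]) z" "set (xs @ [z]) \<subseteq> U"
      using p by (auto simp: is_path_def successively_append_iff hd_append split: if_splits)
    then show ?thesis by blast
  next
    case False
    then have "is_path adj a (p @ [z]) z" "set (p @ [z]) \<subseteq> U"
      using p step.hyps by (auto simp: is_path_def successively_append_iff)
    then show ?thesis by blast
  qed
qed

text \<open>The witness is the set of vertices reachable from \<open>A\<close> by steps into
  \<open>U\<close>. Reaching \<open>B\<close> would give a forbidden path, and an edge from the set
  to another vertex of \<open>U\<close> would make that vertex reachable.\<close>

lemma separation_obtains_closed_set:
  assumes sep: "\<And>a b p. a \<in> A \<Longrightarrow> b \<in> B \<Longrightarrow> is_path adj a p b \<Longrightarrow> \<not> set p \<subseteq> U" and "A \<subseteq> U"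
  obtains C where "A \<subseteq> C" "C \<inter> B = {}" "\<And>i j. i \<in> C \<Longrightarrow> j \<in> U - C \<Longrightarrow> \<not> adj i j"
proof
  let ?C = "{v. \<exists>a\<in>A. (\<lambda>i j. adj i j \<and> j \<in> U)\<^sup>*\<^sup>* a v}"
  show "A \<subseteq> ?C" by blast
  show "?C \<inter> B = {}"
    using rtranclp_imp_is_path[of adj U] sep \<open>A \<subseteq> U\<close> by blast
  show "\<not> adj i j" if "i \<in> ?C" "j \<in> U - ?C" for i j
    using that by (auto intro: rtranclp.rtrancl_into_rtrancl)
qed

lemma dpp_indep_var:
  fixes K :: "real^'v^'v::finite"
  assumes dpp: "dpp M Y K" and CD: "C \<inter> D = {}"
    and K: "\<And>i j. i \<in> C \<Longrightarrow> j \<in> D \<Longrightarrow> K $ i $ j = 0"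
  shows "prob_space.indep_var M (count_space UNIV) (\<lambda>\<omega>. Y \<omega> \<inter> C) (count_space UNIV) (\<lambda>\<omega>. Y \<omega> \<inter> D)"
proof -
  interpret prob_space M using dpp by (simp add: dpp_def)
  \<comment> \<open>The defining identity covers nonempty sets; for the empty set both sides are
    1.\<close>
  have det: "\<P>(\<omega> in M. T \<subseteq> Y \<omega>) = det_principal K T" for T
    using dpp by (cases "T = {}") (auto simp: dpp_def prob_space)
  show ?thesis
  proof (rule indep_var_random_sets)
    show "Y \<in> measurable M (count_space UNIV)" using dpp by (simp add: dpp_def)
    show "\<P>(\<omega> in M. T \<union> U \<subseteq> Y \<omega>) = \<P>(\<omega> in M. T \<subseteq> Y \<omega>) * \<P>(\<omega> in M. U \<subseteq> Y \<omega>)"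
      if "T \<subseteq> C" "U \<subseteq> D" for T U
      unfolding det
    proof (rule det_principal_Un)
      show "T \<inter> U = {}" using that CD by blast
      show "K $ i $ j = 0" if "i \<in> T" "j \<in> U" for i j
        using that \<open>T \<subseteq> C\<close> \<open>U \<subseteq> D\<close> K by blast
    qed
  qed
qed

theorem proposition4:
  fixes M :: "'w measure" and Y :: "'w \<Rightarrow> 'v::finite set" and K :: "real^'v^'v"
  assumes "dpp M Y K"
  shows "bidirected_markov (bidirected_graph K) (binary_law M Y)"
  unfolding bidirected_markov_def
proof (intro allI impI, elim conjE)
  fix A B S :: "'v set"
  let ?U = "A \<union> B \<union> S" and ?X = "binary_vector Y"
  assume disj: "A \<inter> B = {}" "A \<inter> S = {}" "B \<inter> S = {}"
    and sep: "\<forall>a\<in>A. \<forall>b\<in>B. \<forall>p. is_path (bidirected_graph K) a p b \<longrightarrow> (\<exists>v\<in>set p. v \<notin> ?U)"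
  interpret prob_space M using assms by (simp add: dpp_def)
  obtain C where C: "A \<subseteq> C" "C \<inter> B = {}"
    and closed: "\<And>i j. i \<in> C \<Longrightarrow> j \<in> ?U - C \<Longrightarrow> \<not> bidirected_graph K i j"
    by (rule separation_obtains_closed_set[of A B "bidirected_graph K" ?U]) (use sep in blast)+
  define D where "D = ?U - C"
  \<comment> \<open>Vertices of the disjoint sets \<open>C\<close> and \<open>D\<close> are
    distinct, so their non-adjacency forces a zero kernel entry.\<close>
  have ind: "indep_var (count_space UNIV) (\<lambda>\<omega>. Y \<omega> \<inter> C) (count_space UNIV) (\<lambda>\<omega>. Y \<omega> \<inter> D)"
    by (rule dpp_indep_var[OF assms]) (use closed in \<open>auto simp: D_def bidirected_graph_def\<close>)
  have Y: "Y \<in> measurable M (count_space UNIV)" using assms by (simp add: dpp_def)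
  have X: "?X \<in> measurable M (count_space (UNIV \<rightarrow> {0, 1}))"
    unfolding binary_vector_def[abs_def] by (rule measurable_compose[OF Y]) auto
  let ?x = "\<lambda>T v. if v \<in> T then 1 else 0 :: nat"
  have "cond_indep M (\<lambda>\<omega>. restrict (?X \<omega>) A) (\<lambda>\<omega>. restrict (?X \<omega>) B) (\<lambda>\<omega>. restrict (?X \<omega>) S)"
  \<comment> \<open>Here \<open>A \<subseteq> C\<close>, while \<open>B\<close> and
    \<open>S - C\<close> lie in \<open>D\<close>. The map \<open>h\<close> glues the coordinates of
    \<open>S\<close> in \<open>C\<close>, read from \<open>Y \<omega> \<inter> C\<close>, to the
    others, read from \<open>Y \<omega> \<inter> D\<close>; two glued vectors agree iff both pieces
    do.\<close>
  proof (rule cond_indep_of_indep_var[OF ind, where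
        f = "\<lambda>T. restrict (?x T) A" and g = "\<lambda>T. restrict (?x T) B" and
        h = "\<lambda>T T'. restrict (\<lambda>v. if v \<in> C then ?x T v else ?x T' v) S" and
        ?h1.0 = "\<lambda>T. restrict (?x T) (S \<inter> C)" and ?h2.0 = "\<lambda>T. restrict (?x T) (S - C)"])
    fix \<omega>
    show "restrict (?X \<omega>) A = restrict (?x (Y \<omega> \<inter> C)) A"
      using C by (auto simp: binary_vector_def restrict_def fun_eq_iff)
    show "restrict (?X \<omega>) B = restrict (?x (Y \<omega> \<inter> D)) B"
      using C by (auto simp: binary_vector_def restrict_def fun_eq_iff D_def)
    show "restrict (?X \<omega>) S = restrict (\<lambda>v. if v \<in> C then ?x (Y \<omega> \<inter> C) v else ?x (Y \<omega> \<inter> D) v) S"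
      by (auto simp: binary_vector_def restrict_def fun_eq_iff D_def)
  next
    fix T T' U U' :: "'v set"
    show "restrict (\<lambda>v. if v \<in> C then ?x T v else ?x U v) S =
          restrict (\<lambda>v. if v \<in> C then ?x T' v else ?x U' v) S \<longleftrightarrow>
        restrict (?x T) (S \<inter> C) = restrict (?x T') (S \<inter> C) \<and>
        restrict (?x U) (S - C) = restrict (?x U') (S - C)"
      unfolding restrict_def fun_eq_iff by (auto split: if_splits)
  qed
  then show "cond_indep (binary_law M Y) (\<lambda>x. restrict x A) (\<lambda>x. restrict x B) (\<lambda>x. restrict x S)"
    unfolding binary_law_def cond_indep_distr_count_space[OF X] .
qed

end
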